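(* Let $r>2$, $r'=r/(r-1)$, and let $0<p\le r'$. Then the operator \[ \mathcal V^r_{\mathbb P}f(x):=\mathcal V^r\Big(\sum_{n\ne 0} f(x-n)\,\Lambda(|n|)\,\frac{e^{2\pi i\lambda n}}{n}:\lambda\in\mathbb T\Big),\qquad x\in\mathbb Z, \] is unbounded on $\ell^p(\mathbb Z)$; that is, there is no finite constant $C$ such that $\|\mathcal V^r_{\mathbb P}f\|_{\ell^p(\mathbb Z)}\le C\|f\|_{\ell^p(\mathbb Z)}$ for all finitely supported $f:\mathbb Z\to\mathbb C$.
   Context: $\Lambda$ is the von Mangoldt function: $\Lambda(m)=\log p$ if $m=p^k$ is a power of a prime $p$ ($k\ge1$), and $\Lambda(m)=0$ otherwise. For scalars $(a_\lambda)$ indexed by a subset of $\mathbb R$ and $0<r<\infty$, $\mathcal V^r(a_\lambda:\lambda):=\sup\big(\sum_i|a_{\lambda_i}-a_{\lambda_{i+1}}|^r\big)^{1/r}$, the supremum being over all finite increasing sequences of indices; $\mathbb T=\mathbb R/\mathbb Z$ is identified with $[0,1)$. For families of functions the variation is taken pointwise in $x$. *)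

theory Defs
  imports "HOL-Analysis.Analysis" "HOL-Number_Theory.Prime_Powers"
begin

text \<open>
  Real powers of extended nonnegative numbers, only used for exponents \<open>a > 0\<close>; hence
  \<open>\<infinity>\<close> is sent to \<open>\<infinity>\<close>, and \<open>0\<close> is sent to \<open>0\<close> (as in \<open>0 powr a = 0\<close>).
\<close>

definition ennreal_powr :: "ennreal \<Rightarrow> real \<Rightarrow> ennreal" where
  "ennreal_powr x a = (if x = top then top else ennreal (enn2real x powr a))"

text \<open>
  The supremum is taken in \<open>[0,\<infinity>]\<close>. An increasing sequence of \<open>N + 1\<close> indices is the
  restriction of \<open>t\<close> to \<open>{..N}\<close>; a sequence of length one contributes \<open>0\<close>.
\<close>

definition variation :: "real \<Rightarrow> real set \<Rightarrow> (real \<Rightarrow> 'a::real_normed_vector) \<Rightarrow> ennreal" where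
  "variation r I a =
     (SUP (N, t) \<in> {(N :: nat, t :: nat \<Rightarrow> real). strict_mono_on {..N} t \<and> t ` {..N} \<subseteq> I}.
        ennreal ((\<Sum>i<N. norm (a (t i) - a (t (Suc i))) powr r) powr (1 / r)))"

text \<open>
  The \<open>\<ell>\<^sup>p(\<int>)\<close> (quasi-)norm of a function with values in \<open>[0,\<infinity>]\<close>; it is \<open>\<infinity>\<close> exactly when
  the function is not in \<open>\<ell>\<^sup>p(\<int>)\<close>.
\<close>

definition lp_norm :: "real \<Rightarrow> (int \<Rightarrow> ennreal) \<Rightarrow> ennreal" where
  "lp_norm p g = ennreal_powr (\<Sum>\<^sub>\<infinity>x. ennreal_powr (g x) p) (1 / p)"

text \<open>
  For finitely supported \<open>f\<close> only finitely many terms are nonzero, so no question of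
  convergence arises.
\<close>

definition prime_modulated_hilbert :: "(int \<Rightarrow> complex) \<Rightarrow> real \<Rightarrow> int \<Rightarrow> complex" where
  "prime_modulated_hilbert f \<theta> x =
     (\<Sum>\<^sub>\<infinity>n \<in> {n. n \<noteq> 0}.
        f (x - n) * mangoldt (nat \<bar>n\<bar>) * (exp (2 * pi * \<i> * \<theta> * of_int n) / of_int n))"

definition prime_variation :: "real \<Rightarrow> (int \<Rightarrow> complex) \<Rightarrow> int \<Rightarrow> ennreal" where
  "prime_variation r f x = variation r {0..<1} (\<lambda>\<theta>. prime_modulated_hilbert f \<theta> x)"

end

(*
  Test the inequality on the unit mass at 0. At x = n > 0 the family is
  \<Lambda>(n)/n times the character \<theta> \<mapsto> exp(2\<pi>i\<theta>n), which flips sign n times along the indices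
  i/(2n), i = 0, ..., n; so the variation is at least \<Lambda>(n) n^(1/r-1) = \<Lambda>(n) n^(-1/r').
  For p \<le> r' its p-th power dominates a constant times \<Lambda>(n)/n, and the sum of \<Lambda>(n)/n
  diverges by Chebyshev's identity ln N! = \<Sum>_{d \<le> N} \<Lambda>(d) \<lfloor>N/d\<rfloor>.
*)

theory Submission
  imports Defs
begin

section \<open>Divergence of the series of \<Lambda>(n)/n\<close>

lemma ln_fact_lower_bound: "real N * ln N - N \<le> ln (fact N)"
proof (induction N)
  case (Suc N)
  show ?case
  proof (cases "N = 0")
    case False
    have "ln (real (Suc N)) - ln N = ln (real (Suc N) / N)"
      using False by (simp add: ln_div)
    also have "real (Suc N) / N = 1 + 1 / N"
      using False by (simp add: field_simps)
    also have "ln \<dots> \<le> 1 / N"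
      by (rule ln_add_one_self_le_self) auto
    \<comment> \<open>Passing from \<open>N\<close> to \<open>Suc N\<close> increases
      \<open>N * ln N\<close> by \<open>ln (Suc N)\<close> plus this quantity. The subtracted linear
      term, which grows by 1, pays for the latter.\<close>
    finally have "N * (ln (real (Suc N)) - ln N) \<le> 1"
      using False by (simp add: field_simps)
    moreover have "ln (fact (Suc N) :: real) = ln (real (Suc N)) + ln (fact N)"
      by (simp add: ln_mult)
    ultimately show ?thesis
      using Suc.IH by (simp add: algebra_simps)
  qed auto
qed auto

lemma card_multiples_le:
  assumes "d > 0"
  shows "card {n \<in> {1..N}. d dvd n} \<le> N div d"
proof -
  have "{n \<in> {1..N}. d dvd n} \<subseteq> (\<lambda>k. d * k) ` {1..N div d}"
    using assms by (auto simp: dvd_def image_iff less_eq_div_iff_mult_less_eq mult.commute)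
  then have "card {n \<in> {1..N}. d dvd n} \<le> card {1..N div d}"
    by (meson card_image_le card_mono finite_atLeastAtMost finite_imageI le_trans)
  then show ?thesis by simp
qed

text \<open>Writing each \<open>ln n\<close> as the sum of \<Lambda> over the divisors of
  \<open>n\<close> and interchanging the sums, \<Lambda>(d) is counted once for each multiple of
  \<open>d\<close> up to \<open>N\<close>, hence at most \<open>N / d\<close> times.\<close>

lemma ln_fact_le_sum_mangoldt:
  "ln (fact N) \<le> real N * (\<Sum>d=1..N. mangoldt d / d)"
proof -
  have "ln (fact N :: real) = ln (\<Prod>n=1..N. real n)"
    by (simp add: fact_prod)
  also have "\<dots> = (\<Sum>n=1..N. ln (real n))"
    by (rule ln_prod) auto
  \<comment> \<open>Since 0 < n \<le> N, the range \<open>{1..N}\<close> contains all divisors of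
    \<open>n\<close>; making it explicit puts the double sum in a form that can be
    interchanged.\<close>
  also have "\<dots> = (\<Sum>n=1..N. \<Sum>d | d \<in> {1..N} \<and> d dvd n. mangoldt d)"
  proof (rule sum.cong [OF refl])
    fix n assume n: "n \<in> {1..N}"
    then have "{d. d \<in> {1..N} \<and> d dvd n} = {d. d dvd n}"
      by (auto dest: dvd_imp_le intro: Suc_leI dvd_pos_nat)
    then show "ln (real n) = (\<Sum>d | d \<in> {1..N} \<and> d dvd n. mangoldt d)"
      using n mangoldt_sum[of n, where ?'a = real] by simp
  qed
  also have "\<dots> = (\<Sum>d=1..N. \<Sum>n | n \<in> {1..N} \<and> d dvd n. mangoldt d)"
    by (rule sum.swap_restrict) auto
  also have "\<dots> = (\<Sum>d=1..N. real (card {n \<in> {1..N}. d dvd n}) * mangoldt d)"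
    by simp
  also have "\<dots> \<le> (\<Sum>d=1..N. (real N / d) * mangoldt d)"
  proof (intro sum_mono mult_right_mono mangoldt_nonneg)
    fix d assume "d \<in> {1..N}"
    then have "card {n \<in> {1..N}. d dvd n} \<le> N div d"
      by (intro card_multiples_le) auto
    then show "real (card {n \<in> {1..N}. d dvd n}) \<le> real N / d"
      by (meson of_nat_mono order_trans of_nat_div_le_of_nat)
  qed
  also have "\<dots> = real N * (\<Sum>d=1..N. mangoldt d / d)"
    by (simp add: sum_distrib_left)
  finally show ?thesis .
qed

lemma sum_mangoldt_over_n_unbounded: "\<exists>N. B \<le> (\<Sum>n=1..N. mangoldt n / real n)"
proof
  \<comment> \<open>With this choice \<open>ln N\<close> is at least \<open>B + 1\<close>; the extra
    1 absorbs the linear loss in the lower bound for \<open>ln (fact N)\<close>, since the two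
    bounds together give \<open>ln N - 1\<close> as a lower bound for the sum.\<close>
  define N where "N = nat \<lceil>exp (B + 1)\<rceil>"
  have N: "real N \<ge> exp (B + 1)"
    unfolding N_def by linarith
  then have pos: "real N > 0"
    using exp_gt_zero[of "B + 1"] by linarith
  have "B + 1 \<le> ln N"
    using N pos by (simp add: ln_ge_iff)
  moreover have "real N * (ln N - 1) \<le> real N * (\<Sum>d=1..N. mangoldt d / d)"
    using ln_fact_lower_bound[of N] ln_fact_le_sum_mangoldt[of N] by (simp add: algebra_simps)
  ultimately show "B \<le> (\<Sum>n=1..N. mangoldt n / real n)"
    using pos by (simp add: mult_le_cancel_left)
qed

section \<open>Powers of the von Mangoldt function\<close>

lemma mangoldt_ge_ln_2:
  assumes "mangoldt n \<noteq> (0 :: real)"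
  shows "ln 2 \<le> (mangoldt n :: real)"
proof -
  have "primepow n"
    using assms by (auto simp: mangoldt_def split: if_splits)
  then have "aprimedivisor n \<ge> 2"
    using aprimedivisor_gt_Suc_0_nat[OF primepow_gt_Suc_0] by (simp add: Suc_le_eq numeral_2_eq_2)
  then show ?thesis
    using \<open>primepow n\<close> by (simp add: mangoldt_def)
qed

text \<open>Here \<open>s\<close> stands for 1/r'. One factor \<Lambda>(n) is split off from the
  \<open>p\<close>-th power. The remaining power \<open>p - 1\<close> is bounded below through
  \<Lambda>(n) \<ge> ln 2 if p \<ge> 1, and through \<Lambda>(n) \<le> n if p < 1.\<close>

lemma mangoldt_powr_lower_bound:
  assumes p: "0 < p" and s: "p * s \<le> 1" "0 \<le> s" "s \<le> 1" and n: "n > 0"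
  shows "min 1 (ln 2 powr (p - 1)) * (mangoldt n / n) \<le> (real n powr (- s) * mangoldt n) powr p"
proof (cases "mangoldt n = (0 :: real)")
  case False
  define L :: real where "L = mangoldt n"
  have L: "ln 2 \<le> L"
    using mangoldt_ge_ln_2[OF False] by (simp add: L_def)
  then have L0: "L > 0"
    using ln_gt_zero[of "2 :: real"] by linarith
  have Ln: "L \<le> n"
    using mangoldt_le[OF n] ln_le_minus_one[of "real n"] n by (simp add: L_def)
  have "min 1 (ln 2 powr (p - 1)) * (1 / n) \<le> real n powr (- s * p) * L powr (p - 1)"
  proof (cases "p \<ge> 1")
    case True
    have "ln 2 powr (p - 1) \<le> L powr (p - 1)"
      using L True by (intro powr_mono2) auto
    moreover have "1 / n \<le> real n powr (- s * p)"
      using powr_mono[of "-1" "- s * p" "real n"] n s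
      by (simp add: powr_minus_divide mult.commute)
    ultimately show ?thesis
      by (subst mult.commute) (intro mult_mono, auto)
  next
    case False
    have "min 1 (ln 2 powr (p - 1)) * (1 / n) \<le> 1 * (1 / n)"
      by (intro mult_right_mono) auto
    \<comment> \<open>For p < 1 the power \<open>p - 1\<close> is decreasing, so the upper bound
      \<open>n\<close> for \<open>L\<close> is the useful one. The loss is affordable because s
      \<le> 1 leaves \<open>n powr (- p)\<close> available, and the exponents add up to -1.\<close>
    also have "\<dots> = real n powr (- p) * n powr (p - 1)"
      using n by (simp add: powr_neg_one flip: powr_add)
    also have "\<dots> \<le> real n powr (- s * p) * L powr (p - 1)"
    proof (rule mult_mono)
      have "s * p \<le> 1 * p" using s p by (intro mult_right_mono) auto
      then show "real n powr - p \<le> real n powr (- s * p)"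
        using n by (intro powr_mono) auto
      show "real n powr (p - 1) \<le> L powr (p - 1)"
        using Ln L0 False by (intro powr_mono2') auto
    qed auto
    finally show ?thesis .
  qed
  then have "min 1 (ln 2 powr (p - 1)) * (1 / n) * L \<le> real n powr (- s * p) * L powr (p - 1) * L"
    using L0 by (intro mult_right_mono) auto
  also have "\<dots> = (real n powr (- s) * L) powr p"
    using L0 by (simp add: powr_mult powr_powr powr_diff)
  finally show ?thesis
    by (simp add: L_def)
qed simp

section \<open>Powers in [0,\<infinity>] and lower bounds for the variation\<close>

lemma ennreal_powr_mono:
  assumes "x \<le> y" and "0 < a"
  shows "ennreal_powr x a \<le> ennreal_powr y a"
\<comment> \<open>Infinite \<open>y\<close> is separated because \<open>enn2real\<close> sends
  \<open>top\<close> to 0 and so is monotone only below \<open>top\<close>.\<close>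
proof (cases "y = top")
  case False
  then have "x \<noteq> top" "enn2real x \<le> enn2real y"
    using assms by (auto simp: top_unique less_top intro!: enn2real_mono)
  then show ?thesis
    using False assms by (auto simp: ennreal_powr_def intro!: ennreal_leI powr_mono2)
qed (simp add: ennreal_powr_def)

lemma ennreal_powr_ennreal: "0 \<le> x \<Longrightarrow> ennreal_powr (ennreal x) a = ennreal (x powr a)"
  by (simp add: ennreal_powr_def)

lemma variation_ge:
  assumes "strict_mono_on {..N} t" and "t ` {..N} \<subseteq> I"
  shows "ennreal ((\<Sum>i<N. norm (a (t i) - a (t (Suc i))) powr r) powr (1 / r)) \<le> variation r I a"
  unfolding variation_def by (rule SUP_upper2[of "(N, t)"]) (use assms in auto)

lemma variation_character_ge:
  fixes c :: complex
  assumes n: "n > 0" and r: "r > 0"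
  shows "ennreal (real n powr (1 / r) * norm c)
           \<le> variation r {0..<1} (\<lambda>\<theta>. c * exp (2 * pi * \<i> * \<theta> * of_nat n))"
proof -
  \<comment> \<open>At i/(2n) the phase is \<pi> i, so consecutive values of the character are
    opposite signs and differ by 2 in modulus. The last point is 1/2, so all of them stay in
    [0,1).\<close>
  define t :: "nat \<Rightarrow> real" where "t i = i / (2 * n)" for i
  have "strict_mono_on {..n} t"
    using n by (auto simp: strict_mono_on_def t_def divide_strict_right_mono)
  moreover have "t ` {..n} \<subseteq> {0..<1}"
    using n by (auto simp: t_def)
  ultimately have "ennreal ((\<Sum>i<n. norm (c * exp (2 * pi * \<i> * t i * of_nat n)
        - c * exp (2 * pi * \<i> * t (Suc i) * of_nat n)) powr r) powr (1 / r))
      \<le> variation r {0..<1} (\<lambda>\<theta>. c * exp (2 * pi * \<i> * \<theta> * of_nat n))"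
    by (rule variation_ge)
  moreover have "exp (2 * pi * \<i> * t i * of_nat n) = (-1) ^ i" for i
  proof -
    have "2 * pi * \<i> * t i * of_nat n = of_nat i * (pi * \<i>)"
      using n by (simp add: t_def)
    then show ?thesis
      by (simp only: exp_of_nat_mult exp_pi_i)
  qed
  moreover have "norm (c * (-1) ^ i - c * (-1) ^ Suc i) = 2 * norm c" for i :: nat
    by (simp add: norm_mult norm_power)
  ultimately have "ennreal ((n * (2 * norm c) powr r) powr (1 / r))
      \<le> variation r {0..<1} (\<lambda>\<theta>. c * exp (2 * pi * \<i> * \<theta> * of_nat n))"
    by simp
  moreover have "real n powr (1 / r) * norm c \<le> (n * (2 * norm c) powr r) powr (1 / r)"
  proof -
    have "real n powr (1 / r) * norm c \<le> real n powr (1 / r) * (2 * norm c)"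
      by (intro mult_left_mono) auto
    also have "\<dots> = (n * (2 * norm c) powr r) powr (1 / r)"
      using r by (simp add: powr_mult powr_powr)
    finally show ?thesis .
  qed
  ultimately show ?thesis
    by (rule order_trans [OF ennreal_leI, rotated])
qed

text \<open>The character has amplitude \<Lambda>(n)/n, and its variation contributes the factor
  \<open>n powr (1 / r)\<close>; the resulting exponent of \<open>n\<close> is -1/r'.\<close>

lemma prime_variation_unit_mass_ge:
  assumes n: "n > 0" and r: "r > 0"
  shows "ennreal (real n powr (- (1 - 1 / r)) * mangoldt n)
           \<le> prime_variation r (\<lambda>x. of_bool (x = 0)) (int n)"
proof -
  define c :: complex where "c = mangoldt n / n"
  have "prime_modulated_hilbert (\<lambda>x. of_bool (x = 0)) \<theta> (int n)
      = c * exp (2 * pi * \<i> * \<theta> * of_nat n)" for \<theta>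
  proof -
    \<comment> \<open>The unit mass at n - k vanishes unless k = n, and n > 0 places this
      \<open>k\<close> among the nonzero indices.\<close>
    have "prime_modulated_hilbert (\<lambda>x. of_bool (x = 0)) \<theta> (int n)
        = (\<Sum>\<^sub>\<infinity>k\<in>{int n}. mangoldt (nat \<bar>k\<bar>) * (exp (2 * pi * \<i> * \<theta> * of_int k) / of_int k))"
      unfolding prime_modulated_hilbert_def
      by (rule infsum_cong_neutral) (use n in auto)
    then show ?thesis
      by (simp add: c_def)
  qed
  then have "ennreal (real n powr (1 / r) * norm c)
      \<le> prime_variation r (\<lambda>x. of_bool (x = 0)) (int n)"
    using variation_character_ge[OF n r, of c] by (simp add: prime_variation_def)
  moreover have "real n powr (1 / r) * norm c = real n powr (- (1 - 1 / r)) * mangoldt n"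
    using n by (simp add: c_def norm_divide powr_diff)
  ultimately show ?thesis
    by simp
qed

section \<open>The norms of the unit mass and of its variation\<close>

lemma lp_norm_unit_mass: "lp_norm p (\<lambda>x. ennreal (norm (of_bool (x = 0) :: complex))) = 1"
proof -
  have "(\<Sum>\<^sub>\<infinity>x. ennreal_powr (ennreal (norm (of_bool (x = (0 :: int)) :: complex))) p)
      = (\<Sum>\<^sub>\<infinity>x\<in>{0 :: int}. 1)"
    by (rule infsum_cong_neutral) (auto simp: ennreal_powr_def)
  then show ?thesis
    by (simp add: lp_norm_def ennreal_powr_def)
qed

text \<open>At positive integers the \<open>p\<close>-th powers dominate a constant multiple of
  \<Lambda>(n)/n, whose partial sums are unbounded.\<close>

lemma lp_norm_prime_variation_unit_mass:
  assumes r: "r > 1" and p: "0 < p" "p \<le> r / (r - 1)"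
  shows "lp_norm p (prime_variation r (\<lambda>x. of_bool (x = 0))) = top"
proof -
  let ?V = "prime_variation r (\<lambda>x. of_bool (x = 0))"
  define S where "S = (\<Sum>\<^sub>\<infinity>x. ennreal_powr (?V x) p)"
  define s where "s = 1 - 1 / r"
  define c :: real where "c = min 1 (ln 2 powr (p - 1))"
  have c: "c > 0"
    by (simp add: c_def)
  \<comment> \<open>As s = 1/r', the condition p \<le> r' is the same as p s \<le> 1.\<close>
  have s: "p * s \<le> 1" "0 \<le> s" "s \<le> 1"
    using r p by (auto simp: s_def field_simps)
  have term_ge: "ennreal (c * (mangoldt n / n)) \<le> ennreal_powr (?V (int n)) p" if n: "n > 0" for n
  proof -
    have "ennreal (c * (mangoldt n / n)) \<le> ennreal ((real n powr (- s) * mangoldt n) powr p)"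
      unfolding c_def using mangoldt_powr_lower_bound[OF p(1) s n] by (rule ennreal_leI)
    also have "\<dots> = ennreal_powr (ennreal (real n powr (- s) * mangoldt n)) p"
      by (simp add: ennreal_powr_ennreal mangoldt_nonneg)
    also have "\<dots> \<le> ennreal_powr (?V (int n)) p"
      unfolding s_def using n r p by (intro ennreal_powr_mono prime_variation_unit_mass_ge) auto
    finally show ?thesis .
  qed
  have S_ge: "ennreal (c * (\<Sum>n=1..N. mangoldt n / n)) \<le> S" for N
  proof -
    have "ennreal (c * (\<Sum>n=1..N. mangoldt n / n)) = (\<Sum>n=1..N. ennreal (c * (mangoldt n / n)))"
      using c by (simp add: sum_distrib_left sum_ennreal mangoldt_nonneg)
    also have "\<dots> \<le> (\<Sum>n=1..N. ennreal_powr (?V (int n)) p)"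
      by (intro sum_mono term_ge) auto
    also have "\<dots> = (\<Sum>\<^sub>\<infinity>x\<in>int ` {1..N}. ennreal_powr (?V x) p)"
      by (simp add: sum.reindex)
    \<comment> \<open>The terms lie in [0,\<infinity>], so every family is summable and enlarging
      the index set can only increase the sum.\<close>
    also have "\<dots> \<le> S"
      unfolding S_def by (rule infsum_mono_neutral) (auto intro: nonneg_summable_on_complete)
    finally show ?thesis .
  qed
  have "S = top"
  proof (rule ccontr)
    assume "S \<noteq> top"
    \<comment> \<open>If \<open>S\<close> were finite, this \<open>N\<close> would give a partial
      sum exceeding it by at least 1.\<close>
    obtain N where "(enn2real S + 1) / c \<le> (\<Sum>n=1..N. mangoldt n / real n)"
      using sum_mangoldt_over_n_unbounded by blast
    then have "enn2real S + 1 \<le> c * (\<Sum>n=1..N. mangoldt n / real n)"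
      using c by (simp add: field_simps)
    then have "ennreal (enn2real S + 1) \<le> S"
      using S_ge[of N] ennreal_leI order_trans by blast
    then have "ennreal (enn2real S + 1) \<le> ennreal (enn2real S)"
      using \<open>S \<noteq> top\<close> by (simp add: less_top)
    then show False
      by simp
  qed
  then show ?thesis
    by (simp add: lp_norm_def S_def ennreal_powr_def)
qed

theorem mainTheorem3:
  fixes r p :: real
  assumes "r > 2" and "0 < p" and "p \<le> r / (r - 1)"
  shows "\<not> (\<exists>C :: real. \<forall>f :: int \<Rightarrow> complex. finite {x. f x \<noteq> 0} \<longrightarrow>
           lp_norm p (prime_variation r f) \<le> ennreal C * lp_norm p (\<lambda>x. ennreal (norm (f x))))"
proof (rule notI, elim exE)
  fix C :: real
  let ?f = "\<lambda>x :: int. of_bool (x = 0) :: complex"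
  assume bound: "\<forall>f :: int \<Rightarrow> complex. finite {x. f x \<noteq> 0} \<longrightarrow>
           lp_norm p (prime_variation r f) \<le> ennreal C * lp_norm p (\<lambda>x. ennreal (norm (f x)))"
  have "lp_norm p (prime_variation r ?f)
      \<le> ennreal C * lp_norm p (\<lambda>x. ennreal (norm (?f x)))"
    by (rule bound [rule_format]) simp
  moreover have "lp_norm p (prime_variation r ?f) = top"
    using assms by (intro lp_norm_prime_variation_unit_mass) auto
  \<comment> \<open>The unit mass has norm 1, so the bound would read \<open>top\<close> \<le>
    \<open>ennreal C\<close>, which fails for every real \<open>C\<close>.\<close>
  ultimately show False
    by (simp add: lp_norm_unit_mass top_unique)
qed

end
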